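(* Let $T$ be a tree and $C_6$ the cycle of length $6$. Then $\chi_s'(T\Box C_6)\le 2\Delta(T)+6$.
   Context: $\Delta(T)$ is the maximum degree of $T$. The Cartesian product $G\Box H$ has vertex set $V(G)\times V(H)$, with $(a,u)\sim(b,v)$ iff either $a=b$ and $uv\in E(H)$, or $u=v$ and $ab\in E(G)$. A strong edge coloring is a proper edge coloring in which every color class is an induced matching; $\chi_s'(G)$ is the minimum number of colors in such a coloring. *)

theory Defs
  imports Main
begin

record 'a simple_graph =
  vertices :: "'a set"
  edges :: "'a set set"

definition finite_simple_graph :: "'a simple_graph \<Rightarrow> bool" where
  "finite_simple_graph G \<longleftrightarrow>
     finite (vertices G) \<and> (\<forall>e \<in> edges G. e \<subseteq> vertices G \<and> card e = 2)"

definition adjacent :: "'a simple_graph \<Rightarrow> 'a \<Rightarrow> 'a \<Rightarrow> bool" where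
  "adjacent G u v \<longleftrightarrow> {u, v} \<in> edges G"

definition degree :: "'a simple_graph \<Rightarrow> 'a \<Rightarrow> nat" where
  "degree G v = card {u \<in> vertices G. adjacent G v u}"

text \<open>Meaningful for finite graphs with at least one vertex; trees are such by definition below.\<close>

definition max_degree :: "'a simple_graph \<Rightarrow> nat" where
  "max_degree G = Max (degree G ` vertices G)"

definition is_walk :: "'a simple_graph \<Rightarrow> 'a list \<Rightarrow> bool" where
  "is_walk G p \<longleftrightarrow> p \<noteq> [] \<and> set p \<subseteq> vertices G \<and> successively (adjacent G) p"

definition is_connected :: "'a simple_graph \<Rightarrow> bool" where
  "is_connected G \<longleftrightarrow> vertices G \<noteq> {} \<and>
     (\<forall>u \<in> vertices G. \<forall>v \<in> vertices G. \<exists>p. is_walk G p \<and> hd p = u \<and> last p = v)"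

text \<open>A cycle is listed without repeating its starting vertex; three vertices are the minimum,
  so going back and forth along one edge is not a cycle.\<close>

definition is_cycle :: "'a simple_graph \<Rightarrow> 'a list \<Rightarrow> bool" where
  "is_cycle G p \<longleftrightarrow>
     is_walk G p \<and> distinct p \<and> 3 \<le> length p \<and> adjacent G (last p) (hd p)"

definition is_tree :: "'a simple_graph \<Rightarrow> bool" where
  "is_tree G \<longleftrightarrow> finite_simple_graph G \<and> is_connected G \<and> (\<nexists>p. is_cycle G p)"

text \<open>The cycle of length \<open>n\<close>, for \<open>n \<ge> 3\<close>.\<close>

definition cycle_graph :: "nat \<Rightarrow> nat simple_graph" where
  "cycle_graph n =
     \<lparr>vertices = {..<n}, edges = {{i, Suc i mod n} | i. i < n}\<rparr>"

definition cartesian_product ::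
  "'a simple_graph \<Rightarrow> 'b simple_graph \<Rightarrow> ('a \<times> 'b) simple_graph" where
  "cartesian_product G H =
     \<lparr>vertices = vertices G \<times> vertices H,
      edges = {{(a, u), (b, v)} | a u b v.
        a \<in> vertices G \<and> u \<in> vertices H \<and> b \<in> vertices G \<and> v \<in> vertices H \<and>
        (a = b \<and> adjacent H u v \<or> u = v \<and> adjacent G a b)}\<rparr>"

definition matching :: "'a simple_graph \<Rightarrow> 'a set set \<Rightarrow> bool" where
  "matching G M \<longleftrightarrow> M \<subseteq> edges G \<and> (\<forall>e \<in> M. \<forall>f \<in> M. e \<noteq> f \<longrightarrow> e \<inter> f = {})"

text \<open>A matching is induced if the subgraph induced by its endpoints has no further edges.\<close>

definition induced_matching :: "'a simple_graph \<Rightarrow> 'a set set \<Rightarrow> bool" where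
  "induced_matching G M \<longleftrightarrow> matching G M \<and> {e \<in> edges G. e \<subseteq> \<Union>M} = M"

definition proper_edge_coloring :: "'a simple_graph \<Rightarrow> ('a set \<Rightarrow> nat) \<Rightarrow> bool" where
  "proper_edge_coloring G c \<longleftrightarrow>
     (\<forall>e \<in> edges G. \<forall>f \<in> edges G. e \<noteq> f \<and> e \<inter> f \<noteq> {} \<longrightarrow> c e \<noteq> c f)"

definition strong_edge_coloring :: "'a simple_graph \<Rightarrow> ('a set \<Rightarrow> nat) \<Rightarrow> bool" where
  "strong_edge_coloring G c \<longleftrightarrow>
     proper_edge_coloring G c \<and> (\<forall>k \<in> c ` edges G. induced_matching G {e \<in> edges G. c e = k})"

definition strong_chromatic_index :: "'a simple_graph \<Rightarrow> nat" where
  "strong_chromatic_index G =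
     (LEAST k. \<exists>c. strong_edge_coloring G c \<and> card (c ` edges G) = k)"

text \<open>For a finite simple graph the minimum is taken over a nonempty set, hence attained.\<close>

lemma finite_edges: "finite (edges G)" if "finite_simple_graph G"
proof (rule finite_subset)
  show "edges G \<subseteq> Pow (vertices G)"
    using that by (auto simp: finite_simple_graph_def)
  show "finite (Pow (vertices G))"
    using that by (simp add: finite_simple_graph_def)
qed

lemma strong_chromatic_index_attained:
  assumes "finite_simple_graph G"
  shows "\<exists>c. strong_edge_coloring G c \<and> card (c ` edges G) = strong_chromatic_index G"
proof -
  obtain c :: "'a set \<Rightarrow> nat" where c: "inj_on c (edges G)"
    using finite_imp_inj_to_nat_seg[OF finite_edges[OF assms]] by blast
  have sub: "e = f" if "e \<in> edges G" "f \<in> edges G" "e \<subseteq> f" for e f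
  proof (rule card_subset_eq)
    have "card e = 2" "card f = 2"
      using that assms by (auto simp: finite_simple_graph_def)
    then show "finite f" "card e = card f"
      by (auto intro: card_ge_0_finite)
  qed (fact that(3))
  have "induced_matching G {e \<in> edges G. c e = k}" if "k \<in> c ` edges G" for k
  proof -
    from that obtain f where f: "f \<in> edges G" "k = c f"
      by blast
    have "{e \<in> edges G. c e = k} = {f}"
      using f c by (auto dest: inj_onD)
    then show ?thesis
      using f sub by (auto simp: induced_matching_def matching_def)
  qed
  then have "strong_edge_coloring G c"
    using c by (auto simp: strong_edge_coloring_def proper_edge_coloring_def dest: inj_onD)
  then have "\<exists>k. \<exists>c. strong_edge_coloring G c \<and> card (c ` edges G) = k"
    by blast
  then show ?thesis
    unfolding strong_chromatic_index_def by (rule LeastI_ex)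
qed

lemma finite_simple_graph_cycle_graph:
  assumes "3 \<le> n"
  shows "finite_simple_graph (cycle_graph n)"
proof -
  have "i \<noteq> Suc i mod n \<and> Suc i mod n < n" if "i < n" for i
    using that assms by (cases "Suc i = n") auto
  then show ?thesis
    by (auto simp: finite_simple_graph_def cycle_graph_def card_2_iff)
qed

lemma finite_simple_graph_cartesian_product:
  assumes "finite_simple_graph G" "finite_simple_graph H"
  shows "finite_simple_graph (cartesian_product G H)"
proof -
  have "a \<noteq> b" if "adjacent G a b" for a b
    using that assms(1) by (fastforce simp: finite_simple_graph_def adjacent_def)
  moreover have "u \<noteq> v" if "adjacent H u v" for u v
    using that assms(2) by (fastforce simp: finite_simple_graph_def adjacent_def)
  ultimately have "(a, u) \<noteq> (b, v)" if "a = b \<and> adjacent H u v \<or> u = v \<and> adjacent G a b" for a b u v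
    using that by blast
  note ne = this
  have "card e = 2" if "e \<in> edges (cartesian_product G H)" for e
  proof -
    from that obtain a u b v where "e = {(a, u), (b, v)}"
      "a = b \<and> adjacent H u v \<or> u = v \<and> adjacent G a b"
      by (auto simp: cartesian_product_def)
    with ne show ?thesis
      by (simp add: card_insert_if)
  qed
  moreover have "e \<subseteq> vertices (cartesian_product G H)" if "e \<in> edges (cartesian_product G H)" for e
    using that by (auto simp: cartesian_product_def)
  moreover have "finite (vertices (cartesian_product G H))"
    using assms by (simp add: cartesian_product_def finite_simple_graph_def)
  ultimately show ?thesis
    by (simp add: finite_simple_graph_def)
qed

end

theory Submission
  imports Defs
begin

text \<open>Properly colour the edges of the tree \<open>T\<close> with \<open>D = \<Delta>(T)\<close> colours \<open>k\<close>, and choose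
  signs \<open>s v j\<close> such that crossing an edge \<open>uv\<close> flips exactly the signs with \<open>j \<noteq> k(uv)\<close>.
  The \<open>i\<close>-th copy of the tree edge \<open>uv\<close> receives the pair consisting of \<open>k(uv)\<close> and the parity
  of \<open>s u (k(uv)) + i\<close>. Consecutive copies of one edge then differ in the parity, and
  two edges of equal colour \<open>j\<close> joined by a third edge, necessarily of another colour, differ in
  the sign at \<open>j\<close>. This uses \<open>2D\<close> colours. The sign at \<open>j = D\<close>, which is no edge colour, flips
  across every edge and so is a bipartition of \<open>T\<close>; each of its two parts gets three
  further colours, with which the copies of \<open>C\<^sub>6\<close> are coloured periodically.\<close>

section \<open>Signed edge colourings of finite forests\<close>

text \<open>The first vertex \<open>x\<close> of a longest path works: a neighbour off the path
  would lengthen it, and one further along than the second vertex would close a cycle. Isolated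
  vertices count too.\<close>

lemma ex_leaf:
  fixes E :: "'a \<Rightarrow> 'a \<Rightarrow> bool"
  assumes fin: "finite W" and "W \<noteq> {}"
    and sym: "\<And>u v. E u v \<Longrightarrow> E v u" and irrefl: "\<And>u. \<not> E u u"
    and acyclic: "\<And>p. set p \<subseteq> W \<Longrightarrow> distinct p \<Longrightarrow> 3 \<le> length p \<Longrightarrow> successively E p
      \<Longrightarrow> \<not> E (last p) (hd p)"
  shows "\<exists>x\<in>W. \<forall>y\<in>W. \<forall>z\<in>W. E x y \<longrightarrow> E x z \<longrightarrow> y = z"
proof -
  let ?path = "\<lambda>p. p \<noteq> [] \<and> set p \<subseteq> W \<and> distinct p \<and> successively E p"
  obtain w where "w \<in> W" using \<open>W \<noteq> {}\<close> by blast
  then have "?path [w]" by simp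
  moreover have "\<forall>p. ?path p \<longrightarrow> length p < Suc (card W)"
    by (metis card_mono distinct_card fin less_Suc_eq_le)
  ultimately obtain p where p: "?path p" and longest: "\<And>q. ?path q \<Longrightarrow> length q \<le> length p"
    using ex_has_greatest_nat[of ?path "[w]" length "Suc (card W)"] by auto
  then obtain x q where pq: "p = x # q" by (cases p) auto
  have second: "q \<noteq> [] \<and> y = hd q" if "y \<in> W" "E x y" for y
  proof -
    have "y \<in> set p"
    proof (rule ccontr)
      assume "y \<notin> set p"
      then have "?path (y # p)"
        using p that pq sym by (auto simp: successively_Cons)
      then show False using longest[of "y # p"] by simp
    qed
    then have "y \<in> set q" using that irrefl pq by auto
    then obtain as bs where q: "q = as @ y # bs" by (meson split_list)
    \<comment> \<open>Otherwise the segment of the path from \<open>x\<close> to \<open>y\<close>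
      has at least three vertices and is closed by the edge \<open>yx\<close>.\<close>
    have "as = []"
    proof (rule ccontr)
      assume "as \<noteq> []"
      let ?c = "x # as @ [y]"
      have "p = ?c @ bs" using pq q by simp
      then have "set ?c \<subseteq> W" "distinct ?c" "successively E ?c"
        using p by (auto simp only: successively_append_iff distinct_append set_append)
      moreover have "3 \<le> length ?c" using \<open>as \<noteq> []\<close> by (cases as) auto
      ultimately show False using acyclic[of ?c] sym that by simp
    qed
    then show ?thesis using q by simp
  qed
  moreover have "x \<in> W" using p pq by auto
  ultimately show ?thesis by blast
qed

text \<open>The index \<open>j\<close> is not restricted to \<open>j < D\<close>: index
  \<open>D\<close>, the colour of no edge, is what yields the bipartition. Taking \<open>k\<close>
  on sets makes it independent of orientation.\<close>

definition signed_edge_coloring ::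
  "'a set \<Rightarrow> ('a \<Rightarrow> 'a \<Rightarrow> bool) \<Rightarrow> nat \<Rightarrow> ('a set \<Rightarrow> nat) \<Rightarrow> ('a \<Rightarrow> nat \<Rightarrow> bool) \<Rightarrow> bool" where
  "signed_edge_coloring W E D k s \<longleftrightarrow>
    (\<forall>u\<in>W. \<forall>v\<in>W. E u v \<longrightarrow> k {u, v} < D \<and> (\<forall>j. s u j = s v j \<longleftrightarrow> j = k {u, v})) \<and>
    (\<forall>u\<in>W. \<forall>v\<in>W. \<forall>w\<in>W. E u v \<longrightarrow> E u w \<longrightarrow> k {u, v} = k {u, w} \<longrightarrow> v = w)"

lemma signed_edge_coloringI:
  assumes "\<And>u v. u \<in> W \<Longrightarrow> v \<in> W \<Longrightarrow> E u v \<Longrightarrow> k {u, v} < D"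
   and "\<And>u v j. u \<in> W \<Longrightarrow> v \<in> W \<Longrightarrow> E u v \<Longrightarrow> s u j = s v j \<longleftrightarrow> j = k {u, v}"
   and "\<And>u v w. u \<in> W \<Longrightarrow> v \<in> W \<Longrightarrow> w \<in> W \<Longrightarrow> E u v \<Longrightarrow> E u w
        \<Longrightarrow> k {u, v} = k {u, w} \<Longrightarrow> v = w"
  shows "signed_edge_coloring W E D k s"
  unfolding signed_edge_coloring_def
  by (intro conjI ballI impI allI) (rule assms; assumption)+

text \<open>Induction by removing a vertex \<open>x\<close> with at most one neighbour
  \<open>y\<close>. The edge \<open>xy\<close> gets a colour free at \<open>y\<close>, and the signs
  at \<open>x\<close> are then dictated by those at \<open>y\<close> alone.\<close>

lemma forest_signed_edge_coloring:
  fixes E :: "'a \<Rightarrow> 'a \<Rightarrow> bool" and D :: nat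
  assumes fin: "finite W"
    and sym: "\<And>u v. E u v \<Longrightarrow> E v u" and irrefl: "\<And>u. \<not> E u u"
    and acyclic: "\<And>p. set p \<subseteq> W \<Longrightarrow> distinct p \<Longrightarrow> 3 \<le> length p \<Longrightarrow> successively E p
      \<Longrightarrow> \<not> E (last p) (hd p)"
    and deg: "\<And>v. v \<in> W \<Longrightarrow> card {u \<in> W. E v u} \<le> D"
  shows "\<exists>k s. signed_edge_coloring W E D k s"
  using fin acyclic deg
proof (induction W rule: finite_psubset_induct)
  case (psubset W)
  show ?case
  proof (cases "W = {}")
    case False
    have "\<exists>x\<in>W. \<forall>y\<in>W. \<forall>z\<in>W. E x y \<longrightarrow> E x z \<longrightarrow> y = z"
      by (rule ex_leaf) (fact psubset.hyps False sym irrefl psubset.prems(1))+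
    then obtain x where x: "x \<in> W" "\<And>y z. y \<in> W \<Longrightarrow> z \<in> W \<Longrightarrow> E x y \<Longrightarrow> E x z \<Longrightarrow> y = z"
      by blast
    let ?W = "W - {x}"
    have "\<exists>k s. signed_edge_coloring ?W E D k s"
    proof (rule psubset.IH)
      show "?W \<subset> W" using x by blast
      show "\<not> E (last p) (hd p)"
        if "set p \<subseteq> ?W" "distinct p" "3 \<le> length p" "successively E p" for p
        using that psubset.prems(1)[of p] by blast
      show "card {u \<in> ?W. E v u} \<le> D" if "v \<in> ?W" for v
      proof -
        have "card {u \<in> ?W. E v u} \<le> card {u \<in> W. E v u}"
          using psubset.hyps by (intro card_mono) auto
        then show ?thesis using psubset.prems(2)[of v] that by simp
      qed
    qed
    then obtain k s where ks: "signed_edge_coloring ?W E D k s" by blast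
    then have
      lt: "\<And>u v. u \<in> ?W \<Longrightarrow> v \<in> ?W \<Longrightarrow> E u v \<Longrightarrow> k {u, v} < D"
      and sgn: "\<And>u v j. u \<in> ?W \<Longrightarrow> v \<in> ?W \<Longrightarrow> E u v \<Longrightarrow> s u j = s v j \<longleftrightarrow> j = k {u, v}"
      and inj: "\<And>u v w. u \<in> ?W \<Longrightarrow> v \<in> ?W \<Longrightarrow> w \<in> ?W \<Longrightarrow> E u v \<Longrightarrow> E u w
        \<Longrightarrow> k {u, v} = k {u, w} \<Longrightarrow> v = w"
      unfolding signed_edge_coloring_def by blast+
    show ?thesis
    proof (cases "\<exists>y\<in>W. E x y")
      case False
      then have old: "u \<in> ?W \<and> v \<in> ?W" if "u \<in> W" "v \<in> W" "E u v" for u v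
        using that sym by blast
      have "signed_edge_coloring W E D k s"
        by (rule signed_edge_coloringI) (use old lt sgn inj in metis)+
      then show ?thesis by blast
    next
      case True
      then obtain y where y: "y \<in> W" "E x y" by blast
      have only: "z = y" if "z \<in> W" "E x z \<or> E z x" for z
        using x(2) y that sym by blast
      have "y \<noteq> x" using y irrefl by auto
      \<comment> \<open>Since \<open>x\<close> is itself one of the at most \<open>D\<close>
        neighbours of \<open>y\<close>, fewer than \<open>D\<close> colours are taken at
        \<open>y\<close>.\<close>
      let ?N = "{u \<in> ?W. E y u}"
      have "{u \<in> W. E y u} = insert x ?N"
        using x y sym by auto
      then have "card {u \<in> W. E y u} = Suc (card ?N)"
        using psubset.hyps by simp
      then have "card ?N < D" using psubset.prems(2)[OF y(1)] by simp
      moreover have "card ((\<lambda>u. k {y, u}) ` ?N) \<le> card ?N"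
        using psubset.hyps by (intro card_image_le) auto
      ultimately have "\<not> {..<D} \<subseteq> (\<lambda>u. k {y, u}) ` ?N"
        using psubset.hyps card_mono[of "(\<lambda>u. k {y, u}) ` ?N" "{..<D}"] by auto
      then obtain m where m: "m < D" "\<And>u. u \<in> ?W \<Longrightarrow> E y u \<Longrightarrow> k {y, u} \<noteq> m"
        by blast
      define k' where "k' = k({x, y} := m)"
      define s' where "s' = s(x := \<lambda>j. if j = m then s y j else \<not> s y j)"
      have k'_old: "k' {u, v} = k {u, v}" if "u \<in> ?W" "v \<in> ?W" for u v
        using that by (auto simp: k'_def doubleton_eq_iff)
      have k'_new: "k' {x, y} = m" "k' {y, x} = m"
        by (auto simp: k'_def insert_commute)
      have s'_old: "s' u = s u" if "u \<in> ?W" for u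
        using that by (auto simp: s'_def)
      have s'_new: "s' x j = s' y j \<longleftrightarrow> j = m" for j
        using \<open>y \<noteq> x\<close> by (auto simp: s'_def)
      have cases_edge: "(u \<in> ?W \<and> v \<in> ?W) \<or> (u = x \<and> v = y) \<or> (u = y \<and> v = x)"
        if "u \<in> W" "v \<in> W" "E u v" for u v
        using that only by blast
      have "signed_edge_coloring W E D k' s'"
      proof (rule signed_edge_coloringI)
        show "k' {u, v} < D" if "u \<in> W" "v \<in> W" "E u v" for u v
          using cases_edge[OF that] lt[of u v] that(3) m(1) k'_new k'_old[of u v] by auto
        show "s' u j = s' v j \<longleftrightarrow> j = k' {u, v}" if "u \<in> W" "v \<in> W" "E u v" for u v j
          using cases_edge[OF that] sgn[of u v j] that(3) k'_new s'_new[of j]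
            k'_old[of u v] s'_old[of u] s'_old[of v] by auto
        show "v = w"
          if "u \<in> W" "v \<in> W" "w \<in> W" "E u v" "E u w" "k' {u, v} = k' {u, w}" for u v w
        proof (cases "u = x")
          case True
          then show ?thesis using only that by blast
        next
          case False
          then have "u \<in> ?W" using that by simp
          have new: "k' {u, z} = m \<longleftrightarrow> z = x" if "z \<in> W" "E u z" "u = y" for z
            using that k'_new(2) k'_old[of u z] m(2)[of z] \<open>u \<in> ?W\<close> by (cases "z = x") auto
          show ?thesis
          proof (cases "u = y \<and> (v = x \<or> w = x)")
            case True
            then show ?thesis using new that by metis
          next
            case False
            then have "v \<in> ?W" "w \<in> ?W" using \<open>u \<noteq> x\<close> cases_edge that by blast+
            then show ?thesis using inj[of u v w] that \<open>u \<in> ?W\<close> k'_old by simp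
          qed
        qed
      qed
      then show ?thesis by blast
    qed
  qed (simp add: signed_edge_coloring_def)
qed

section \<open>Strong colourings and adjacency in the product\<close>

text \<open>Reduces the task to separating edges that meet or are joined by an edge. An edge inside
  the union of a colour class has its ends in two members of the class; these must coincide, so it
  equals that member by cardinality.\<close>

lemma strong_edge_coloringI:
  assumes G: "finite_simple_graph G"
    and conflict: "\<And>e f x y. e \<in> edges G \<Longrightarrow> f \<in> edges G \<Longrightarrow> e \<noteq> f \<Longrightarrow> x \<in> e \<Longrightarrow> y \<in> f
      \<Longrightarrow> x = y \<or> adjacent G x y \<Longrightarrow> c e \<noteq> c f"
  shows "strong_edge_coloring G c"
proof -
  have "induced_matching G {e \<in> edges G. c e = k}" for k
  proof -
    let ?M = "{e \<in> edges G. c e = k}"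
    have "g \<in> ?M" if g: "g \<in> edges G" "g \<subseteq> \<Union>?M" for g
    proof -
      have "card g = 2" using g G by (auto simp: finite_simple_graph_def)
      then obtain x y where xy: "g = {x, y}" by (auto simp: card_2_iff)
      then obtain e f where e: "e \<in> ?M" "x \<in> e" and f: "f \<in> ?M" "y \<in> f"
        using g by auto
      have "adjacent G x y" using g xy by (simp add: adjacent_def)
      then have "e = f" using conflict[of e f x y] e f by auto
      then have "g \<subseteq> e" using e f xy by auto
      moreover have "card e = 2" using e G by (auto simp: finite_simple_graph_def)
      moreover from this have "finite e" by (simp add: card_ge_0_finite)
      ultimately have "g = e"
        using \<open>card g = 2\<close> card_subset_eq[of e g] by simp
      then show ?thesis using e by simp
    qed
    then show ?thesis
      using conflict unfolding induced_matching_def matching_def by blast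
  qed
  then show ?thesis
    using conflict unfolding strong_edge_coloring_def proper_edge_coloring_def by blast
qed

lemma adjacent_cycle_graph:
  "adjacent (cycle_graph n) a b \<longleftrightarrow> a < n \<and> b = Suc a mod n \<or> b < n \<and> a = Suc b mod n"
  by (auto simp: adjacent_def cycle_graph_def doubleton_eq_iff)

lemma adjacent_cartesian_product:
  assumes "finite_simple_graph G" "finite_simple_graph H"
  shows "adjacent (cartesian_product G H) (a, u) (b, v) \<longleftrightarrow>
    a = b \<and> a \<in> vertices G \<and> adjacent H u v \<or> u = v \<and> u \<in> vertices H \<and> adjacent G a b"
proof -
  have "a \<in> vertices G \<and> b \<in> vertices G" if "adjacent G a b" for a b
    using assms(1) that by (auto simp: finite_simple_graph_def adjacent_def)
  moreover have "u \<in> vertices H \<and> v \<in> vertices H" if "adjacent H u v" for u v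
    using assms(2) that by (auto simp: finite_simple_graph_def adjacent_def)
  ultimately show ?thesis
    unfolding adjacent_def[of "cartesian_product G H"] cartesian_product_def
    by (auto simp: doubleton_eq_iff adjacent_def insert_commute; blast)
qed

lemma mod_2_add_left_cancel: "(x + i) mod 2 = (x + j) mod 2 \<longleftrightarrow> i mod 2 = j mod 2"
  for x i j :: nat
  by (auto simp: mod2_eq_if)

lemma of_bool_mod_2_add_right_cancel: "(of_bool P + i) mod 2 = (of_bool Q + i) mod 2 \<longleftrightarrow> P = Q"
  for i :: nat
  by (cases P; cases Q; simp add: mod2_eq_if)

section \<open>The colouring of the product and its verification\<close>

theorem theorem10:
  fixes T :: "'a simple_graph"
  assumes "is_tree T"
  shows "strong_chromatic_index (cartesian_product T (cycle_graph 6)) \<le> 2 * max_degree T + 6"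
proof -
  let ?C = "cycle_graph 6" and ?G = "cartesian_product T (cycle_graph 6)"
  define D where "D = max_degree T"
  have fT: "finite_simple_graph T" using assms by (simp add: is_tree_def)
  have fC: "finite_simple_graph ?C" by (rule finite_simple_graph_cycle_graph) simp
  have fG: "finite_simple_graph ?G" by (rule finite_simple_graph_cartesian_product[OF fT fC])
  have sym: "adjacent T v u" if "adjacent T u v" for u v
    using that by (simp add: adjacent_def insert_commute)
  have irrefl: "\<not> adjacent T u u" for u
    using fT by (fastforce simp: adjacent_def finite_simple_graph_def)
  have vert: "u \<in> vertices T \<and> v \<in> vertices T" if "adjacent T u v" for u v
    using fT that by (auto simp: adjacent_def finite_simple_graph_def)
  have "\<exists>k s. signed_edge_coloring (vertices T) (adjacent T) D k s"
  proof (rule forest_signed_edge_coloring)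
    show "finite (vertices T)" using fT by (simp add: finite_simple_graph_def)
    then show "card {u \<in> vertices T. adjacent T v u} \<le> D" if "v \<in> vertices T" for v
      using that by (simp add: D_def max_degree_def degree_def[symmetric])
    show "\<not> adjacent T (last p) (hd p)"
      if "set p \<subseteq> vertices T" "distinct p" "3 \<le> length p" "successively (adjacent T) p" for p
      using assms that unfolding is_tree_def is_cycle_def is_walk_def by auto
  qed (use sym irrefl in auto)
  then obtain k s where ks: "signed_edge_coloring (vertices T) (adjacent T) D k s" by blast
  then have
    k_less: "\<And>u v. adjacent T u v \<Longrightarrow> k {u, v} < D"
    and sgn: "\<And>u v j. adjacent T u v \<Longrightarrow> s u j = s v j \<longleftrightarrow> j = k {u, v}"
    and k_inj: "\<And>u v w. adjacent T u v \<Longrightarrow> adjacent T u w \<Longrightarrow> k {u, v} = k {u, w} \<Longrightarrow> v = w"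
    using vert unfolding signed_edge_coloring_def by blast+

  \<comment> \<open>Both ends of a tree edge have the same sign at its own colour, so the
    existential reads off that common value without choosing an end.\<close>
  define sign where "sign A = (of_bool (\<exists>u\<in>A. s u (k A)) :: nat)" for A
  text \<open>The sums \<open>i + (i + 1)\<close> along the six edges of the cycle are \<open>1, 0, 2, 1, 0, 2\<close> modulo 3.\<close>
  define c where "c e = (if is_singleton (fst ` e)
      then 2 * D + 3 * of_bool (s (the_elem (fst ` e)) D) + \<Sum>(snd ` e) mod 3
      else 2 * k (fst ` e) + (sign (fst ` e) + the_elem (snd ` e)) mod 2)" for e :: "('a \<times> nat) set"

  have edge_cases: "(\<exists>v i. i < 6 \<and> e = {(v, i), (v, Suc i mod 6)}) \<or>
      (\<exists>u w i. adjacent T u w \<and> e = {(u, i), (w, i)})" if "e \<in> edges ?G" for e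
  proof -
    from that obtain a u b v where e: "e = {(a, u), (b, v)}"
      and adj: "a = b \<and> adjacent ?C u v \<or> u = v \<and> adjacent T a b"
      by (auto simp: cartesian_product_def)
    from adj show ?thesis
    proof
      assume ab: "a = b \<and> adjacent ?C u v"
      then have "e = {(a, u), (a, v)}" "e = {(a, v), (a, u)}" using e by auto
      then show ?thesis using ab unfolding adjacent_cycle_graph by blast
    qed (use e in blast)
  qed
  have c_cycle: "c {(v, i), (v, Suc i mod 6)} = 2 * D + 3 * of_bool (s v D) + (i + Suc i mod 6) mod 3"
    if "i < 6" for v i
  proof -
    \<comment> \<open>\<open>c\<close> sums over a set, so the two positions must differ for both to
      be counted.\<close>
    have "i \<noteq> Suc i mod 6" using that by presburger
    then show ?thesis by (simp add: c_def)
  qed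
  have sign: "sign {u, w} = of_bool (s u (k {u, w}))" if "adjacent T u w" for u w
    using sgn[OF that] by (auto simp: sign_def)
  have c_tree: "c {(u, i), (w, i)} = 2 * k {u, w} + (of_bool (s u (k {u, w})) + i) mod 2"
    if "adjacent T u w" for u w i
  proof -
    have "u \<noteq> w" using that irrefl by auto
    then show ?thesis by (simp add: c_def is_singleton_def doubleton_eq_iff sign[OF that])
  qed
  \<comment> \<open>Copies of cycle edges use colours from \<open>2 * D\<close> on, copies of tree
    edges only smaller ones, so mixed pairs never clash.\<close>
  have c_cycle_ge: "2 * D \<le> c {(v, i), (v, Suc i mod 6)}" if "i < 6" for v i
    using c_cycle[OF that] by simp
  have c_tree_less: "c {(u, i), (w, i)} < 2 * D" if "adjacent T u w" for u w i
    using k_less[OF that] unfolding c_tree[OF that] by linarith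
  have "c e < 2 * D + 6" if "e \<in> edges ?G" for e
    using edge_cases[OF that]
  proof (elim disjE exE conjE)
    fix v i assume "i < (6 :: nat)" "e = {(v, i), (v, Suc i mod 6)}"
    moreover have "(i + Suc i mod 6) mod 3 < 3" by simp
    moreover have "of_bool (s v D) \<le> (1 :: nat)" by simp
    ultimately show ?thesis by (simp only: c_cycle)
  qed (simp add: c_tree_less trans_less_add1)
  then have "c ` edges ?G \<subseteq> {..<2 * D + 6}" by auto
  then have card: "card (c ` edges ?G) \<le> 2 * D + 6"
    using card_mono[of "{..<2 * D + 6}"] by fastforce

  have cycle_cycle: False
    if i: "i < 6" and j: "j < 6" and eq: "c {(v, i), (v, Suc i mod 6)} = c {(w, j), (w, Suc j mod 6)}"
      and ne: "{(v, i), (v, Suc i mod 6)} \<noteq> {(w, j), (w, Suc j mod 6)}"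
      and a: "a = i \<or> a = Suc i mod 6" and b: "b = j \<or> b = Suc j mod 6"
      and adj: "(v, a) = (w, b) \<or> adjacent ?G (v, a) (w, b)" for v w i j a b
  proof -
    have mod_less: "(i + Suc i mod 6) mod 3 < 3" "(j + Suc j mod 6) mod 3 < 3" by simp_all
    have "s v D = s w D" and mod: "(i + Suc i mod 6) mod 3 = (j + Suc j mod 6) mod 3"
      using eq mod_less unfolding c_cycle[OF i] c_cycle[OF j]
      by (auto simp: of_bool_def split: if_splits)
    \<comment> \<open>Every tree edge flips the sign at \<open>D\<close>, so equal signs there rule
      out adjacency and force both edges into one copy of the cycle.\<close>
    then have "\<not> adjacent T v w" using sgn[of v w D] k_less[of v w] by auto
    then have "v = w" and ab: "a = b \<or> b = Suc a mod 6 \<or> a = Suc b mod 6"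
      using adj by (auto simp: adjacent_cartesian_product[OF fT fC] adjacent_cycle_graph)
    have "i \<noteq> j" using ne \<open>v = w\<close> by auto
    moreover have "i \<in> {0, 1, 2, 3, 4, 5}" "j \<in> {0, 1, 2, 3, 4, 5}" using i j by auto
    \<comment> \<open>Equal residues leave only opposite edges of the hexagon, whose ends are at
      distance at least 2.\<close>
    ultimately have "(i, j) \<in> {(0, 3), (1, 4), (2, 5), (3, 0), (4, 1), (5, 2)}"
      using mod by auto
    then show False
      using a b ab unfolding insert_iff empty_iff prod.inject
      by (elim disjE conjE; hypsubst; simp)
  qed

  have tree_tree: False
    if uw: "adjacent T u w" and uw': "adjacent T u' w'"
      and eq: "c {(u, i), (w, i)} = c {(u', j), (w', j)}"
      and ne: "{(u, i), (w, i)} \<noteq> {(u', j), (w', j)}"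
      and adj: "(u, i) = (u', j) \<or> adjacent ?G (u, i) (u', j)" for u w u' w' i j
  proof -
    let ?m = "k {u, w}"
    have "2 * k {u, w} + (of_bool (s u (k {u, w})) + i) mod 2
        = 2 * k {u', w'} + (of_bool (s u' (k {u', w'})) + j) mod 2"
      using eq c_tree[OF uw] c_tree[OF uw'] by simp
    moreover have "p = q \<and> x mod 2 = y mod 2" if "2 * p + x mod 2 = 2 * q + y mod 2"
      for p q x y :: nat
      using that by presburger
    ultimately have k: "k {u', w'} = ?m"
      and par: "(of_bool (s u ?m) + i) mod 2 = (of_bool (s u' ?m) + j) mod 2"
      by metis+
    \<comment> \<open>The chosen ends coincide, are neighbours in a copy of the cycle, or are
      neighbours in a copy of \<open>T\<close>.\<close>
    consider "u = u'" "i = j" | "u = u'" "j = Suc i mod 6 \<or> i = Suc j mod 6"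
      | "i = j" "adjacent T u u'"
      using adj by (auto simp: adjacent_cartesian_product[OF fT fC] adjacent_cycle_graph)
    then show False
    proof cases
      case 1
      then show False using k_inj[of u w w'] uw uw' k ne by auto
    next
      case 2
      \<comment> \<open>As 6 is even, parity also changes on the wrap-around from 5 to 0.\<close>
      then have "i mod 2 \<noteq> j mod 2" by (auto simp: mod2_eq_if dvd_mod_iff)
      moreover have "i mod 2 = j mod 2"
        using par \<open>u = u'\<close> mod_2_add_left_cancel by blast
      ultimately show False by simp
    next
      case 3
      have "s u ?m = s u' ?m"
        using par \<open>i = j\<close> of_bool_mod_2_add_right_cancel by blast
      \<comment> \<open>An edge preserves only the sign at its own colour, so \<open>uu'\<close> has
        colour \<open>?m\<close> too; properness at \<open>u\<close> and at \<open>u'\<close> then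
        identifies both given edges with it.\<close>
      then have "k {u, u'} = ?m" using sgn 3 by metis
      then have "u' = w" "u = w'"
        using k_inj[of u u' w] k_inj[of u' u w'] uw uw' 3 sym k by (auto simp: insert_commute)
      then show False using ne 3 by auto
    qed
  qed

  have "strong_edge_coloring ?G c"
  proof (rule strong_edge_coloringI[OF fG])
    fix e f :: "('a \<times> nat) set" and x y
    assume ef: "e \<in> edges ?G" "f \<in> edges ?G" "e \<noteq> f" and xy: "x \<in> e" "y \<in> f"
      "x = y \<or> adjacent ?G x y"
    show "c e \<noteq> c f"
    proof
      assume eq: "c e = c f"
      from edge_cases[OF ef(1)] edge_cases[OF ef(2)] show False
      proof (elim disjE exE conjE)
        fix v i w j assume "i < (6 :: nat)" "j < (6 :: nat)"
          "e = {(v, i), (v, Suc i mod 6)}" "f = {(w, j), (w, Suc j mod 6)}"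
        then show False
          using cycle_cycle[of i j v w "snd x" "snd y"] eq ef xy by auto
      next
        fix u w i u' w' j
        assume uw: "adjacent T u w" "adjacent T u' w'"
          and e: "e = {(u, i), (w, i)}" and f: "f = {(u', j), (w', j)}"
        \<comment> \<open>Each edge is relisted with the end that is involved in the conflict first,
          as \<open>tree_tree\<close> expects.\<close>
        obtain a b where "adjacent T a b" "e = {(a, i), (b, i)}" "x = (a, i)"
          using e xy uw sym by auto
        moreover obtain a' b' where "adjacent T a' b'" "f = {(a', j), (b', j)}" "y = (a', j)"
          using f xy uw sym by auto
        ultimately show False
          using tree_tree[of a b a' b' i j] eq ef xy by simp
      qed (use eq c_cycle_ge c_tree_less in \<open>metis leD\<close>)+
    qed
  qed
  then have "strong_chromatic_index ?G \<le> card (c ` edges ?G)"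
    unfolding strong_chromatic_index_def by (intro Least_le) blast
  then show ?thesis using card by (simp add: D_def)
qed

end
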